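(* Let $L\ge 1$ be an integer, let $A$ be a real $L\times L$ matrix which maps $\overline{\mathbb{R}_+^L}$ into $\overline{\mathbb{R}_+^L}$ and satisfies $\|A\|_2<1$, and let $f\in\overline{\mathbb{R}_+^L}$. Then there exists a unique $u$ satisfying the linear equation $$u=Au+f,$$ and $u\in\overline{\mathbb{R}_+^L}$. In other words, $(I-A)^{-1}\in\overline{\mathbb{R}_+^{L\times L}}$.
   Context: $\mathbb{R}_+^L$ is the positive cone in $\mathbb{R}^L$: $a\in\mathbb{R}_+^L$ means every entry of $a$ is strictly positive; $\overline{\mathbb{R}_+^L}$ is its closure, the vectors with all entries nonnegative. $\overline{\mathbb{R}_+^{L\times L}}$ is the set of $L\times L$ real matrices with all entries nonnegative. $\|A\|_2$ is the operator norm of $A$ induced by the Euclidean norm on $\mathbb{R}^L$. *)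

theory Defs
  imports "HOL-Analysis.Analysis"
begin

definition positive_cone :: "(real ^ 'l) set" where
  "positive_cone = {a. \<forall>i. 0 < a $ i}"

definition nonneg_matrices :: "(real ^ 'l ^ 'l) set" where
  "nonneg_matrices = {M. \<forall>i j. 0 \<le> M $ i $ j}"

lemma mem_closure_positive_cone_iff:
  fixes a :: "real ^ 'l"
  shows "a \<in> closure positive_cone \<longleftrightarrow> (\<forall>i. 0 \<le> a $ i)"
proof
  have "closed {x :: real ^ 'l. \<forall>i. 0 \<le> x $ i}"
    by (intro closed_Collect_all closed_Collect_le continuous_intros)
  moreover have "positive_cone \<subseteq> {x :: real ^ 'l. \<forall>i. 0 \<le> x $ i}"
    by (auto simp: positive_cone_def less_imp_le)
  ultimately have "closure positive_cone \<subseteq> {x :: real ^ 'l. \<forall>i. 0 \<le> x $ i}"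
    by (rule closure_minimal[rotated])
  then show "a \<in> closure positive_cone \<Longrightarrow> \<forall>i. 0 \<le> a $ i" by blast
next
  assume a: "\<forall>i. 0 \<le> a $ i"
  define s where "s n = (\<chi> i. a $ i + inverse (real (Suc n)))" for n
  have "s n \<in> positive_cone" for n
    using a by (simp add: s_def positive_cone_def add_nonneg_pos)
  moreover have "s \<longlonglongrightarrow> a"
  proof (rule vec_tendstoI)
    fix i
    show "(\<lambda>n. s n $ i) \<longlonglongrightarrow> a $ i"
      using tendsto_add[OF tendsto_const LIMSEQ_inverse_real_of_nat, of "a $ i"]
      by (simp add: s_def)
  qed
  ultimately show "a \<in> closure positive_cone"
    unfolding closure_sequential by blast
qed

end

theory Submission
  imports Defs
begin

text \<open>The map \<open>u \<mapsto> A u + f\<close> is a contraction which preserves the closed cone, so by Banach's theorem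
  its only fixed point lies in the cone. Taking for \<open>f\<close> the basis vectors gives the columns of
  \<open>(I - A)\<^sup>-\<^sup>1\<close>.\<close>

lemma norm_matrix_vector_le_onorm:
  fixes A :: "real ^ 'n ^ 'm"
  shows "norm (A *v x) \<le> onorm ((*v) A) * norm x"
  by (rule onorm) (rule matrix_vector_mul_bounded_linear)

text \<open>The inhomogeneity \<open>g\<close> cancels in the difference of two solutions, so
  \<open>A\<close> fixes \<open>u - v\<close>; a nonzero fixed vector would force the operator norm
  to be at least 1.\<close>

lemma fixed_point_of_contractive_matrix_unique:
  fixes A :: "real ^ 'n ^ 'n"
  assumes "onorm ((*v) A) < 1" "u = A *v u + g" "v = A *v v + g"
  shows "u = v"
proof (rule ccontr)
  assume "u \<noteq> v"
  have "u - v = A *v (u - v)"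
    using assms(2,3) by (metis add_diff_cancel_right matrix_vector_mult_diff_distrib)
  then have "norm (u - v) \<le> onorm ((*v) A) * norm (u - v)"
    using norm_matrix_vector_le_onorm[of A "u - v"] by simp
  also have "\<dots> < 1 * norm (u - v)"
    using assms(1) \<open>u \<noteq> v\<close> by (intro mult_strict_right_mono) auto
  finally show False by simp
qed

lemma fixed_point_of_contractive_matrix_exists:
  fixes A :: "real ^ 'n ^ 'n"
  assumes "onorm ((*v) A) < 1" "closed S" "S \<noteq> {}" "\<And>x. x \<in> S \<Longrightarrow> A *v x + g \<in> S"
  shows "\<exists>u\<in>S. u = A *v u + g"
proof -
  have "dist (A *v x + g) (A *v y + g) \<le> onorm ((*v) A) * dist x y" for x y
    using norm_matrix_vector_le_onorm[of A "x - y"]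
    by (simp add: dist_norm matrix_vector_mult_diff_distrib)
  then have "\<exists>!u\<in>S. A *v u + g = u"
    using assms onorm_pos_le[OF matrix_vector_mul_bounded_linear[of A]]
    by (intro Banach_fix[of S "onorm ((*v) A)"]) (auto simp: complete_eq_closed)
  then show ?thesis by metis
qed

lemma mult_matrix_inv_right:
  assumes "invertible A"
  shows "A ** matrix_inv A = mat 1"
  using assms unfolding invertible_def matrix_inv_def by (rule someI2_ex) simp

theorem theorem5:
  fixes A :: "real ^ 'l ^ 'l" and f :: "real ^ 'l"
  assumes A_cone: "\<And>x. x \<in> closure positive_cone \<Longrightarrow> A *v x \<in> closure positive_cone"
    and A_norm: "onorm ((*v) A) < 1"
    and f_cone: "f \<in> closure positive_cone"
  shows "(\<exists>!u. u = A *v u + f)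
       \<and> (\<forall>u. u = A *v u + f \<longrightarrow> u \<in> closure positive_cone)
       \<and> invertible (mat 1 - A)
       \<and> matrix_inv (mat 1 - A) \<in> nonneg_matrices"
proof -
  note unique = fixed_point_of_contractive_matrix_unique[OF A_norm]
  \<comment> \<open>The right-hand side \<open>g\<close> is kept general, to serve both for
    \<open>f\<close> and for the basis vectors.\<close>
  have ex: "\<exists>u\<in>closure positive_cone. u = A *v u + g" if g: "g \<in> closure positive_cone" for g
  proof (rule fixed_point_of_contractive_matrix_exists[OF A_norm])
    show "A *v x + g \<in> closure positive_cone" if "x \<in> closure positive_cone" for x
      using A_cone[OF that] g by (simp add: mem_closure_positive_cone_iff)
  qed (use g in auto)
  \<comment> \<open>Uniqueness holds in the whole space, so any solution coincides with the one
    found in the cone.\<close>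
  then have cone: "u \<in> closure positive_cone"
    if "u = A *v u + g" "g \<in> closure positive_cone" for u g
    using unique that by blast
  \<comment> \<open>A kernel vector solves the equation with zero right-hand side, and so does 0. A
    trivial kernel makes the square matrix invertible.\<close>
  have "x = 0" if "(mat 1 - A) *v x = 0" for x
    using that unique[of x 0 0] by (simp add: matrix_vector_mult_diff_rdistrib)
  then have inv: "invertible (mat 1 - A)"
    by (auto simp: invertible_left_inverse matrix_left_invertible_ker)
  have "0 \<le> matrix_inv (mat 1 - A) $ i $ j" for i j
  proof -
    \<comment> \<open>Column \<open>j\<close> of the inverse, whose entry \<open>i\<close> is the
      one to be bounded.\<close>
    define u where "u = matrix_inv (mat 1 - A) *v axis j 1"
    have "(mat 1 - A) *v u = axis j 1"
      using inv by (simp add: u_def matrix_vector_mul_assoc mult_matrix_inv_right)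
    then have "u = A *v u + axis j 1"
      by (simp add: matrix_vector_mult_diff_rdistrib algebra_simps)
    moreover have "axis j (1::real) \<in> closure positive_cone"
      by (simp add: mem_closure_positive_cone_iff axis_def)
    ultimately have "0 \<le> u $ i"
      using cone mem_closure_positive_cone_iff by blast
    then show ?thesis
      by (simp add: u_def matrix_vector_mult_basis column_def)
  qed
  then have "matrix_inv (mat 1 - A) \<in> nonneg_matrices"
    by (simp add: nonneg_matrices_def)
  then show ?thesis
    using ex[OF f_cone] unique cone f_cone inv by blast
qed

end
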